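(* Let $G$ be a graph, $\theta$ a real number, $k=\mathrm{mult}(\theta,G)$ (possibly $0$), and let $X=\{x_1,\dots,x_m\}$ ($m\ge2$) be a $\theta$-nice set in $G$. Then there exists a set $Y=\{y_1,\dots,y_m\}\subseteq V(G)$ disjoint from $X$ such that: (i) $M=\{x_1y_1,\dots,x_my_m\}$ is a matching of size $m$ in $G$; (ii) for every $M'\subseteq M$, $\mathrm{mult}(\theta,G\setminus V(M'))=k$, where $V(M')$ is the set of endpoints of edges in $M'$, and if $|X\setminus V(M')|\ge2$ then $X\setminus V(M')$ is $\theta$-nice in $G\setminus V(M')$; (iii) $Y$ is an independent set in $G$.
   Context: All graphs are finite and simple. For a graph $G$ on $n$ vertices, let $p(G,r)$ be the number of $r$-matchings of $G$ ($p(G,0)=1$); the matching polynomial is $\mu(G,x)=\sum_{r=0}^{\lfloor n/2\rfloor}(-1)^r p(G,r)x^{n-2r}$ (the graph with no vertices has $\mu=1$). For real $\theta$, $\mathrm{mult}(\theta,G)$ is the multiplicity of $\theta$ as a root of $\mu(G,x)$ (it is $0$ if $\theta$ is not a root). $G\setminus X$ denotes deletion of the vertex set $X$ and its incident edges. A set $X\subseteq V(F)$ with $|X|>1$ is $\theta$-nice in a graph $F$ if $\mathrm{mult}(\theta,F\setminus\{u,v\})=\mathrm{mult}(\theta,F)+2$ for all distinct $u,v\in X$. *)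

theory Defs
  imports "HOL-Computational_Algebra.Polynomial"
begin

text \<open>A finite simple graph is given by a finite vertex set V and a symmetric,
irreflexive adjacency relation E; only adjacencies between vertices of V count.
Vertex deletion G minus X is the graph (V - X, E).\<close>

definition simple_graph :: "'a set \<Rightarrow> ('a \<Rightarrow> 'a \<Rightarrow> bool) \<Rightarrow> bool" where
  "simple_graph V E \<longleftrightarrow> finite V \<and> (\<forall>u v. E u v \<longrightarrow> E v u) \<and> (\<forall>u. \<not> E u u)"

definition edges :: "'a set \<Rightarrow> ('a \<Rightarrow> 'a \<Rightarrow> bool) \<Rightarrow> 'a set set" where
  "edges V E = {{u, v} | u v. u \<in> V \<and> v \<in> V \<and> E u v}"

definition is_matching :: "'a set \<Rightarrow> ('a \<Rightarrow> 'a \<Rightarrow> bool) \<Rightarrow> 'a set set \<Rightarrow> bool" where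
  "is_matching V E M \<longleftrightarrow> M \<subseteq> edges V E \<and> (\<forall>e\<in>M. \<forall>f\<in>M. e \<noteq> f \<longrightarrow> e \<inter> f = {})"

definition num_matchings :: "'a set \<Rightarrow> ('a \<Rightarrow> 'a \<Rightarrow> bool) \<Rightarrow> nat \<Rightarrow> nat" where
  "num_matchings V E r = card {M. is_matching V E M \<and> card M = r}"

definition match_poly :: "'a set \<Rightarrow> ('a \<Rightarrow> 'a \<Rightarrow> bool) \<Rightarrow> real poly" where
  "match_poly V E = (\<Sum>r\<le>card V div 2.
      monom ((-1) ^ r * real (num_matchings V E r)) (card V - 2 * r))"

definition mult :: "real \<Rightarrow> 'a set \<Rightarrow> ('a \<Rightarrow> 'a \<Rightarrow> bool) \<Rightarrow> nat" where
  "mult \<theta> V E = order \<theta> (match_poly V E)"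

definition nice :: "real \<Rightarrow> 'a set \<Rightarrow> ('a \<Rightarrow> 'a \<Rightarrow> bool) \<Rightarrow> 'a set \<Rightarrow> bool" where
  "nice \<theta> V E X \<longleftrightarrow> X \<subseteq> V \<and> card X > 1 \<and>
     (\<forall>u\<in>X. \<forall>v\<in>X. u \<noteq> v \<longrightarrow> mult \<theta> (V - {u, v}) E = mult \<theta> V E + 2)"

definition independent :: "'a set \<Rightarrow> ('a \<Rightarrow> 'a \<Rightarrow> bool) \<Rightarrow> 'a set \<Rightarrow> bool" where
  "independent V E Y \<longleftrightarrow> Y \<subseteq> V \<and> (\<forall>u\<in>Y. \<forall>v\<in>Y. \<not> E u v)"

end

theory Submission
  imports Defs
begin

text \<open>
Write \<open>F S\<close> for the matching polynomial of the graph induced on S, shifted so that \<open>\<theta>\<close> becomes 0.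
Expanding along a vertex u shows by induction that the Rayleigh differences
F(S-u) F(S-v) - F(S) F(S-u-v) and the Wronskians of F(S) and F(S-u) are nonnegative on the real line.
Comparing lowest coefficients, a deletion changes the multiplicity by at most one, and a deletion that
lowers it preserves the sign of the lowest coefficient. Giving a third vertex w a variable
weight makes the Rayleigh difference a nonnegative quadratic polynomial in that weight; its
discriminant forces the multiplicity to grow by 3 when three pairwise nice vertices are deleted, hence
by card A when any subset A of X is deleted.

Let c(S,T) be the coefficient of degree k = mult \<open>\<theta>\<close> V E of F(V-S-T), for S in X and T disjoint from X with
card S = card T. Expanding along a vertex x of X-S leaves only c(S,T) = - sum of c(S+x,T+z) over the neighbours z
of x outside X and T, as all other terms vanish to order greater than k. For S = X all nonzero values c(X,T)
have the same sign, so no cancellation ever occurs. Since c({},{}) is nonzero, partners of the vertices of X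
can be chosen one at a time with c(X,Y) nonzero, and restoring pairs in any order keeps c
nonzero. Finally, an edge between two partners would give a path on four vertices joining two vertices of X whose deletion has
multiplicity k, whereas niceness makes that multiplicity larger than k.
\<close>

section \<open>The vertex recurrence of the matching polynomial\<close>

lemma edgesE:
  assumes "e \<in> edges S E" obtains u v where "e = {u, v}" "u \<in> S" "v \<in> S" "E u v"
  using assms by (auto simp: edges_def)

lemma edges_mono: "S \<subseteq> T \<Longrightarrow> edges S E \<subseteq> edges T E"
  by (auto simp: edges_def)

lemma is_matching_Union_subset: "is_matching S E M \<Longrightarrow> \<Union>M \<subseteq> S"
  by (auto simp: is_matching_def elim!: edgesE dest!: subsetD)

lemma finite_matchings: "finite S \<Longrightarrow> finite {M. is_matching S E M}"
  by (rule finite_subset[of _ "Pow (Pow S)"]) (use is_matching_Union_subset in fastforce)+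

lemma is_matching_mono: "is_matching S E M \<Longrightarrow> S \<subseteq> T \<Longrightarrow> is_matching T E M"
  using edges_mono[of S T E] by (auto simp: is_matching_def)

lemma matching_card_le:
  assumes "finite S" "\<And>u. \<not> E u u" "is_matching S E M"
  shows "2 * card M \<le> card S"
proof -
  have "card e = 2" if "e \<in> M" for e
  proof -
    have "e \<in> edges S E" using assms(3) that by (auto simp: is_matching_def)
    then obtain u v where "e = {u, v}" "E u v" by (rule edgesE)
    then show ?thesis using assms(2) by (cases "u = v") auto
  qed
  moreover have "pairwise disjnt M"
    using assms(3) by (auto simp: is_matching_def pairwise_def disjnt_def)
  moreover have "finite e" if "e \<in> M" for e
    using is_matching_Union_subset[OF assms(3)] that assms(1) by (meson Sup_le_iff finite_subset)
  ultimately have "card (\<Union>M) = 2 * card M"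
    by (subst card_Union_disjoint) auto
  then show ?thesis
    using card_mono[OF assms(1) is_matching_Union_subset[OF assms(3)]] by simp
qed

lemma match_poly_eq_sum:
  assumes "finite S" "\<And>u. \<not> E u u"
  shows "match_poly S E =
    (\<Sum>M | is_matching S E M. monom ((-1) ^ card M) (card S - 2 * card M))"
proof -
  let ?N = "{M. is_matching S E M}"
  have fin: "finite ?N" by (rule finite_matchings[OF assms(1)])
  have "card ` ?N \<subseteq> {..card S div 2}"
    using matching_card_le[of S E] assms by fastforce
  then have "(\<Sum>M\<in>?N. monom ((-1) ^ card M) (card S - 2 * card M)) =
    (\<Sum>r\<le>card S div 2. \<Sum>M\<in>{M\<in>?N. card M = r}. monom ((-1::real) ^ card M) (card S - 2 * card M))"
    by (subst sum.group[OF fin]) auto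
  also have "\<dots> = match_poly S E"
    unfolding match_poly_def
  proof (rule sum.cong[OF refl])
    fix r
    have "(\<Sum>M\<in>{M\<in>?N. card M = r}. monom ((-1::real) ^ card M) (card S - 2 * card M)) =
       (\<Sum>M\<in>{M\<in>?N. card M = r}. monom ((-1) ^ r) (card S - 2 * r))"
      by (rule sum.cong) auto
    also have "\<dots> = monom ((-1) ^ r * real (num_matchings S E r)) (card S - 2 * r)"
      by (simp add: num_matchings_def of_nat_monom mult_monom mult.commute)
    finally show "(\<Sum>M\<in>{M\<in>?N. card M = r}. monom ((-1::real) ^ card M) (card S - 2 * card M)) =
      monom ((-1) ^ r * real (num_matchings S E r)) (card S - 2 * r)" .
  qed
  finally show ?thesis ..
qed

lemma match_poly_nonzero:
  assumes "finite S" "\<And>u. \<not> E u u"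
  shows "match_poly S E \<noteq> 0"
proof -
  have "finite M" if "is_matching S E M" for M
    using is_matching_Union_subset[OF that] assms(1) by (meson finite_UnionD finite_subset)
  then have "is_matching S E M \<and> card M = 0 \<longleftrightarrow> M = {}" for M
    by (metis card_0_eq card.empty empty_iff empty_subsetI is_matching_def)
  then have *: "num_matchings S E 0 = 1" by (simp add: num_matchings_def del: card_eq_0_iff)
  have "coeff (match_poly S E) (card S) =
     (\<Sum>r\<le>card S div 2. if r = 0 then 1 else 0)"
    unfolding match_poly_def coeff_sum
    by (rule sum.cong) (auto simp: *)
  also have "\<dots> = 1" by simp
  finally show ?thesis by auto
qed

lemma match_poly_rec:
  assumes "finite S" "\<And>u. \<not> E u u" "\<And>u v. E u v \<Longrightarrow> E v u" "u \<in> S"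
  shows "match_poly S E = [:0, 1:] * match_poly (S - {u}) E
    - (\<Sum>y | y \<in> S \<and> E u y. match_poly (S - {u, y}) E)"
proof -
  let ?N = "\<lambda>S. {M. is_matching S E M}"
  let ?f = "\<lambda>n M. monom ((-1::real) ^ card M) (n - 2 * card M)"
  let ?Y = "{y. y \<in> S \<and> E u y}"
  let ?B = "\<lambda>y. insert {u, y} ` ?N (S - {u, y})"
  note fin = finite_matchings[of _ E]
  have uncov: "{u, z} \<notin> M \<and> u \<notin> \<Union>M" if "M \<in> ?N (S - A)" "u \<in> A" for M z A
    using is_matching_Union_subset[of _ E M] that by blast
  have split: "?N S = ?N (S - {u}) \<union> (\<Union>y\<in>?Y. ?B y)"
  proof (intro equalityI subsetI)
    fix M assume "M \<in> ?N S"
    then have M: "is_matching S E M" by simp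
    show "M \<in> ?N (S - {u}) \<union> (\<Union>y\<in>?Y. ?B y)"
    proof (cases "u \<in> \<Union>M")
      case False
      have "is_matching (S - {u}) E M"
        using M False unfolding is_matching_def edges_def by fastforce
      then show ?thesis by simp
    next
      case True
      then obtain e where e: "e \<in> M" "u \<in> e" by auto
      then have "e \<in> edges S E" using M by (auto simp: is_matching_def)
      then obtain y where y: "e = {u, y}" "y \<in> S" "E u y"
        using e(2) assms(3) by (elim edgesE) (auto simp: insert_commute)
      have "is_matching (S - {u, y}) E (M - {e})"
        unfolding is_matching_def
      proof (intro conjI subsetI)
        fix g assume g: "g \<in> M - {e}"
        then have "g \<inter> {u, y} = {}" "g \<in> edges S E" using M e y by (auto simp: is_matching_def)
        then show "g \<in> edges (S - {u, y}) E" by (auto simp: edges_def)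
      qed (use M in \<open>auto simp: is_matching_def\<close>)
      moreover have "M = insert {u, y} (M - {e})" using e y by auto
      ultimately show ?thesis using y by blast
    qed
  next
    fix M assume "M \<in> ?N (S - {u}) \<union> (\<Union>y\<in>?Y. ?B y)"
    then consider "is_matching (S - {u}) E M"
      | y M' where "y \<in> S" "E u y" "is_matching (S - {u, y}) E M'" "M = insert {u, y} M'" by blast
    then show "M \<in> ?N S"
    proof cases
      case 1 then show ?thesis using is_matching_mono by fastforce
    next
      case 2
      have "is_matching S E M'" using is_matching_mono[OF 2(3)] by blast
      moreover have "{u, y} \<in> edges S E" using 2 assms(4) by (auto simp: edges_def)
      moreover have "\<forall>g\<in>M'. g \<inter> {u, y} = {}" using is_matching_Union_subset[OF 2(3)] by blast
      ultimately show ?thesis unfolding is_matching_def 2(4) by (auto simp: Int_commute)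
    qed
  qed
  have "match_poly S E = (\<Sum>M\<in>?N (S - {u}). ?f (card S) M) + (\<Sum>M\<in>(\<Union>y\<in>?Y. ?B y). ?f (card S) M)"
    unfolding match_poly_eq_sum[OF assms(1,2)] split
  proof (rule sum.union_disjoint)
    show "finite (?N (S - {u}))" "finite (\<Union>y\<in>?Y. ?B y)" using fin assms(1) by auto
    show "?N (S - {u}) \<inter> (\<Union>y\<in>?Y. ?B y) = {}"
    proof (safe, goal_cases)
      case (1 M y M')
      then show ?case using uncov[of "insert {u, y} M'" "{u}" y] by simp
    qed
  qed
  also have "(\<Sum>M\<in>?N (S - {u}). ?f (card S) M) = [:0, 1:] * match_poly (S - {u}) E"
  proof -
    have "?f (card S) M = [:0, 1:] * ?f (card (S - {u})) M" if "M \<in> ?N (S - {u})" for M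
    proof -
      have "2 * card M \<le> card (S - {u})"
        using matching_card_le[of "S - {u}" E M] assms that by auto
      moreover have "card S = Suc (card (S - {u}))" using card.remove[OF assms(1,4)] .
      ultimately show ?thesis by (simp add: Suc_diff_le monom_Suc)
    qed
    then show ?thesis
      using assms by (simp add: match_poly_eq_sum sum_distrib_left)
  qed
  also have "(\<Sum>M\<in>(\<Union>y\<in>?Y. ?B y). ?f (card S) M) = (\<Sum>y\<in>?Y. \<Sum>M\<in>?B y. ?f (card S) M)"
  proof (rule sum.UNION_disjoint)
    show "finite ?Y" "\<forall>y\<in>?Y. finite (?B y)" using fin assms(1) by auto
    show "\<forall>y\<in>?Y. \<forall>z\<in>?Y. y \<noteq> z \<longrightarrow> ?B y \<inter> ?B z = {}"
    proof (intro ballI impI equals0I)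
      fix y z L assume "y \<noteq> z" "L \<in> ?B y \<inter> ?B z"
      then obtain M M' where *: "M' \<in> ?N (S - {u, z})" "L = insert {u, y} M" "L = insert {u, z} M'"
        by blast
      have "{u, y} \<notin> M'" "{u, y} \<noteq> {u, z}"
        using uncov[OF *(1)] \<open>y \<noteq> z\<close> by (auto simp: doubleton_eq_iff)
      then show False using *(2,3) by (metis insertE insertI1)
    qed
  qed
  also have "\<dots> = (\<Sum>y\<in>?Y. - match_poly (S - {u, y}) E)"
  proof (rule sum.cong[OF refl])
    fix y assume y: "y \<in> ?Y"
    then have "u \<noteq> y" using assms(2) by auto
    then have "card {u, y} = 2" by simp
    moreover have "card {u, y} \<le> card S" "card (S - {u, y}) = card S - card {u, y}"
      using y assms(1,4) by (auto intro: card_mono card_Diff_subset simp del: card_insert_disjoint)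
    ultimately have c: "card S = card (S - {u, y}) + 2" by linarith
    have inj: "inj_on (insert {u, y}) (?N (S - {u, y}))"
    proof (rule inj_onI)
      fix M M' assume *: "M \<in> ?N (S - {u, y})" "M' \<in> ?N (S - {u, y})"
        "insert {u, y} M = insert {u, y} M'"
      have "{u, y} \<notin> M" "{u, y} \<notin> M'" using uncov[OF *(1)] uncov[OF *(2)] by auto
      then show "M = M'" using *(3) insert_ident by metis
    qed
    have "?f (card S) (insert {u, y} M) = - ?f (card (S - {u, y})) M" if M: "M \<in> ?N (S - {u, y})" for M
    proof -
      have "finite M" using M assms(1) is_matching_Union_subset[of "S - {u, y}" E M]
        by (metis finite_Diff finite_UnionD finite_subset mem_Collect_eq)
      moreover have "{u, y} \<notin> M" using uncov[OF M] by blast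
      ultimately show ?thesis unfolding c by (simp add: minus_monom)
    qed
    then show "(\<Sum>M\<in>?B y. ?f (card S) M) = - match_poly (S - {u, y}) E"
      using assms by (simp add: sum.reindex[OF inj] match_poly_eq_sum sum_negf)
  qed
  finally show ?thesis by (simp add: sum_negf)
qed

section \<open>Lowest coefficients of real polynomials\<close>

lemma coeff_mult_monom_dvd:
  fixes p q :: "'a::comm_semiring_1 poly"
  assumes "monom 1 a dvd p" "monom 1 b dvd q"
  shows "coeff (p * q) (a + b) = coeff p a * coeff q b"
proof -
  obtain p' q' where "p = monom 1 a * p'" "q = monom 1 b * q'" using assms by (auto elim!: dvdE)
  then have "p * q = monom 1 (a + b) * (p' * q')" "p = monom 1 a * p'" "q = monom 1 b * q'"
    using mult_monom[of "1::'a" a 1 b] by (simp_all add: mult_ac)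
  then show ?thesis by (simp add: coeff_monom_mult coeff_mult_0)
qed

lemma monom_dvd_mult:
  fixes p q :: "'a::comm_semiring_1 poly"
  assumes "monom 1 a dvd p" "monom 1 b dvd q" "n \<le> a + b"
  shows "monom 1 n dvd p * q"
proof -
  have "monom 1 (a + b) dvd p * q"
    using mult_dvd_mono[OF assms(1,2)] by (simp add: mult_monom)
  then show ?thesis using assms(3) by (simp add: monom_1_dvd_iff')
qed

lemma monom_dvd_pderiv:
  fixes p :: "'a::{comm_semiring_1, semiring_no_zero_divisors} poly"
  shows "monom 1 n dvd p \<Longrightarrow> monom 1 (n - 1) dvd pderiv p"
  by (auto simp: monom_1_dvd_iff' coeff_pderiv)

lemma coeff_order_0_nonzero:
  fixes p :: "'a::idom poly"
  assumes "p \<noteq> 0" shows "coeff p (order 0 p) \<noteq> 0"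
proof
  assume "coeff p (order 0 p) = 0"
  moreover have "monom 1 (order 0 p) dvd p" using assms by (simp add: monom_1_dvd_iff)
  ultimately have "monom 1 (Suc (order 0 p)) dvd p" by (simp add: monom_1_dvd_iff' less_Suc_eq)
  then show False using assms by (simp add: monom_1_dvd_iff)
qed

lemma nonneg_lowest_coeff:
  fixes g :: "real poly"
  assumes "\<And>x. poly g x \<ge> 0" "monom 1 (2 * n) dvd g"
  shows "coeff g (2 * n) \<ge> 0"
proof -
  obtain r where r: "g = monom 1 (2 * n) * r" using assms(2) by blast
  have "poly r x \<ge> 0" if "x \<noteq> 0" for x
  proof -
    have "0 < x ^ (2 * n)" using that by (simp add: power_mult)
    then show ?thesis using assms(1)[of x] by (simp add: r poly_monom zero_le_mult_iff)
  qed
  then have "eventually (\<lambda>x. 0 \<le> poly r x) (at 0)"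
    by (auto simp: eventually_at_filter)
  moreover have "(poly r \<longlongrightarrow> poly r 0) (at 0)"
    by (simp add: isCont_def[symmetric])
  ultimately have "0 \<le> poly r 0" by (intro tendsto_lowerbound[of "poly r"]) auto
  then show ?thesis by (simp add: r coeff_monom_mult poly_0_coeff_0)
qed

lemma discriminant_nonpos:
  fixes a b c :: real
  assumes "\<And>x. 0 \<le> a + b * x + c * x\<^sup>2" "0 \<le> c"
  shows "b\<^sup>2 \<le> 4 * a * c"
proof (cases "c = 0")
  case True
  have "b = 0"
  proof (rule ccontr)
    assume "b \<noteq> 0"
    then show False using assms(1)[of "- (a + 1) / b"] True by simp
  qed
  then show ?thesis using True by simp
next
  case False
  have "0 \<le> 4 * c * (a + b * (- b / (2 * c)) + c * (- b / (2 * c))\<^sup>2)"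
    using assms(2) by (intro mult_nonneg_nonneg assms(1)) simp
  also have "\<dots> = 4 * a * c - b\<^sup>2" using False by (simp add: field_simps power2_eq_square)
  finally show ?thesis by simp
qed

lemma order_pcompose_shift:
  fixes p :: "'a::idom poly"
  assumes "p \<noteq> 0"
  shows "order 0 (pcompose p [:a, 1:]) = order a p"
proof -
  obtain q where q: "p = [:- a, 1:] ^ order a p * q" "\<not> [:- a, 1:] dvd q"
    using order_decomp[OF assms] by blast
  define r where "r = pcompose q [:a, 1:]"
  have pow: "pcompose ([:- a, 1:] ^ n) [:a, 1:] = [:- 0, 1:] ^ n" for n
  proof (induction n)
    case (Suc n)
    have "pcompose [:- a, 1:] [:a, 1:] = [:- 0, 1:]" by (simp add: pcompose_pCons)
    then show ?case by (simp only: power_Suc pcompose_mult Suc.IH)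
  qed (simp add: pcompose_1)
  have r0: "poly r 0 \<noteq> 0" using q(2) by (simp add: r_def poly_pcompose poly_eq_0_iff_dvd)
  then have "r \<noteq> 0" by auto
  have "pcompose p [:a, 1:] = [:- 0, 1:] ^ order a p * r"
    by (subst q(1)) (simp only: pcompose_mult pow r_def)
  also have "order 0 \<dots> = order a p"
    using \<open>r \<noteq> 0\<close> r0 by (subst order_mult) (simp_all only: order_power_n_n order_0I[OF r0], auto)
  finally show ?thesis .
qed

section \<open>Rayleigh differences\<close>

context
  fixes E :: "'a \<Rightarrow> 'a \<Rightarrow> bool" and G :: "'a set \<Rightarrow> real" and wt :: "'a \<Rightarrow> real"
  assumes rec: "\<And>S u. finite S \<Longrightarrow> u \<in> S \<Longrightarrow>
      G S = wt u * G (S - {u}) - (\<Sum>y | y \<in> S \<and> E u y. G (S - {u, y}))"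
    and irr: "\<And>u. \<not> E u u"
begin

lemma rayleigh_difference_rec:
  assumes "finite S" "u \<in> S" "v \<in> S" "u \<noteq> v"
  shows "G (S - {u}) * G (S - {v}) - G S * G (S - {u, v}) =
    (if E u v then (G (S - {u, v}))\<^sup>2 else 0) +
    (\<Sum>y | y \<in> S - {u, v} \<and> E u y.
       G (S - {u} - {y}) * G (S - {u} - {v}) - G (S - {u}) * G (S - {u} - {y, v}))"
proof -
  let ?A = "{y. y \<in> S \<and> E u y}" and ?B = "{y. y \<in> S - {u, v} \<and> E u y}"
  have fin: "finite ?B" using assms(1) by simp
  have A: "?A = ?B \<union> (if E u v then {v} else {})" "v \<notin> ?B" using assms irr by auto
  have "(\<Sum>y\<in>?A. G (S - {u, y})) = (\<Sum>y\<in>?B. G (S - {u, y})) + (if E u v then G (S - {u, v}) else 0)"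
    unfolding A(1) using fin by (subst sum.union_disjoint) auto
  then have 1: "G S = wt u * G (S - {u}) - (\<Sum>y\<in>?B. G (S - {u, y})) - (if E u v then G (S - {u, v}) else 0)"
    using rec[OF assms(1,2)] by simp
  have s: "S - {v} - {u} = S - {u, v}" "\<And>y. S - {v} - {u, y} = S - {u, y, v}"
     "S - {u} - {v} = S - {u, v}" "\<And>y. S - {u} - {y} = S - {u, y}" "\<And>y. S - {u} - {y, v} = S - {u, y, v}"
    "{y. y \<in> S - {v} \<and> E u y} = ?B"
    using irr by auto
  have 2: "G (S - {v}) = wt u * G (S - {u, v}) - (\<Sum>y\<in>?B. G (S - {u, y, v}))"
    using rec[of "S - {v}" u] assms unfolding s by simp
  show ?thesis
    unfolding 2 s sum_subtractf sum_distrib_left[symmetric] sum_distrib_right[symmetric]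
    by (subst 1) (simp add: algebra_simps power2_eq_square)
qed

lemma rayleigh_difference_nonneg:
  assumes "finite S" "u \<in> S" "v \<in> S" "u \<noteq> v"
  shows "0 \<le> G (S - {u}) * G (S - {v}) - G S * G (S - {u, v})"
  using assms
proof (induction "card S" arbitrary: S u rule: less_induct)
  case less
  have "0 \<le> G (S - {u} - {y}) * G (S - {u} - {v}) - G (S - {u}) * G (S - {u} - {y, v})"
    if "y \<in> S - {u, v}" for y
    using less.prems that by (intro less.hyps card_Diff1_less) auto
  then show ?case
    by (subst rayleigh_difference_rec[OF less.prems]) (intro add_nonneg_nonneg sum_nonneg, auto)
qed

lemma rayleigh_difference_ge:
  assumes "finite S" "u \<in> S" "v \<in> S" "u \<noteq> v" "y \<in> S - {u, v}" "E u y"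
  shows "G (S - {u} - {y}) * G (S - {u} - {v}) - G (S - {u}) * G (S - {u} - {y, v})
    \<le> G (S - {u}) * G (S - {v}) - G S * G (S - {u, v})"
proof -
  let ?D = "\<lambda>y. G (S - {u} - {y}) * G (S - {u} - {v}) - G (S - {u}) * G (S - {u} - {y, v})"
  have "?D y \<le> (\<Sum>y | y \<in> S - {u, v} \<and> E u y. ?D y)"
    using assms by (intro member_le_sum rayleigh_difference_nonneg) auto
  then show ?thesis
    by (subst rayleigh_difference_rec[OF assms(1-4)]) (simp add: add_increasing)
qed

lemma rayleigh_difference_ge_path4:
  assumes "finite S" "distinct [u, y, z, v]" "{u, y, z, v} \<subseteq> S" "E u y" "E y z" "E z v"
  shows "(G (S - {u, y, z, v}))\<^sup>2 \<le> G (S - {u}) * G (S - {v}) - G S * G (S - {u, v})"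
proof -
  let ?D = "\<lambda>S u v. G (S - {u}) * G (S - {v}) - G S * G (S - {u, v})"
  let ?T = "S - {u} - {y}"
  have "0 \<le> (\<Sum>a | a \<in> ?T - {z, v} \<and> E z a. ?D (?T - {z}) a v)"
    using assms by (intro sum_nonneg rayleigh_difference_nonneg) auto
  then have "(G (?T - {z, v}))\<^sup>2 \<le> ?D ?T z v"
    using assms by (subst rayleigh_difference_rec) auto
  also have "\<dots> \<le> ?D (S - {u}) y v"
    using assms by (intro rayleigh_difference_ge) auto
  also have "\<dots> \<le> ?D S u v"
    using assms by (intro rayleigh_difference_ge) auto
  also have "?T - {z, v} = S - {u, y, z, v}" by auto
  finally show ?thesis .
qed

end

section \<open>Multiplicities under vertex deletion\<close>

locale irreflexive_symmetric =
  fixes E :: "'a \<Rightarrow> 'a \<Rightarrow> bool" and \<theta> :: real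
  assumes irr: "\<not> E u u" and sym: "E u v \<Longrightarrow> E v u"
begin

text \<open>Shifting the argument turns multiplicities at \<open>\<theta>\<close> into vanishing of low-order coefficients.\<close>
definition F :: "'a set \<Rightarrow> real poly" where
  "F S = pcompose (match_poly S E) [:\<theta>, 1:]"

abbreviation mu :: "'a set \<Rightarrow> nat" where "mu S \<equiv> mult \<theta> S E"

lemma F_rec:
  assumes "finite S" "u \<in> S"
  shows "F S = [:\<theta>, 1:] * F (S - {u}) - (\<Sum>y | y \<in> S \<and> E u y. F (S - {u, y}))"
  unfolding F_def
  by (subst match_poly_rec[OF assms(1) irr sym assms(2)])
    (simp_all only: pcompose_diff pcompose_mult pcompose_sum pcompose_idR, simp add: pcompose_pCons)

lemma poly_F_rec:
  assumes "finite S" "u \<in> S"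
  shows "poly (F S) x = (\<theta> + x) * poly (F (S - {u})) x - (\<Sum>y | y \<in> S \<and> E u y. poly (F (S - {u, y})) x)"
  by (subst F_rec[OF assms]) (simp add: poly_sum algebra_simps)

lemma coeff_F_rec:
  assumes "finite S" "u \<in> S"
  shows "coeff (F S) n = \<theta> * coeff (F (S - {u})) n + (if n = 0 then 0 else coeff (F (S - {u})) (n - 1))
     - (\<Sum>y | y \<in> S \<and> E u y. coeff (F (S - {u, y})) n)"
  by (subst F_rec[OF assms]) (auto simp: coeff_sum coeff_pCons split: nat.split)

lemma F_nonzero: "finite S \<Longrightarrow> F S \<noteq> 0"
  using match_poly_nonzero[of S E] irr by (simp add: F_def pcompose_eq_0_iff)

lemma mu_eq_order: "finite S \<Longrightarrow> mu S = order 0 (F S)"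
  using match_poly_nonzero[of S E] irr by (simp add: F_def mult_def order_pcompose_shift)

lemma monom_dvd_F_iff: "finite S \<Longrightarrow> monom 1 n dvd F S \<longleftrightarrow> n \<le> mu S"
  by (simp add: monom_1_dvd_iff F_nonzero mu_eq_order)

lemma coeff_F_eq_0: "finite S \<Longrightarrow> n < mu S \<Longrightarrow> coeff (F S) n = 0"
  using monom_dvd_F_iff[of S "mu S"] by (simp add: monom_1_dvd_iff')

lemma coeff_F_mu: "finite S \<Longrightarrow> coeff (F S) (mu S) \<noteq> 0"
  by (simp add: coeff_order_0_nonzero F_nonzero mu_eq_order)

lemma wronskian_ge:
  assumes "finite S" "u \<in> S"
  shows "(poly (F (S - {u})) x)\<^sup>2 \<le>
    poly (F (S - {u}) * pderiv (F S) - F S * pderiv (F (S - {u}))) x"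
  using assms
proof (induction "card S" arbitrary: S u rule: less_induct)
  case less
  let ?W = "\<lambda>S u. F (S - {u}) * pderiv (F S) - F S * pderiv (F (S - {u}))"
  let ?Y = "{y. y \<in> S \<and> E u y}"
  have s: "S - {u} - {y} = S - {u, y}" for y by auto
  have "0 \<le> poly (?W (S - {u}) y) x" if "y \<in> ?Y" for y
  proof (rule order_trans[OF zero_le_power2 less.hyps])
    show "y \<in> S - {u}" using that irr by auto
  qed (use less.prems in \<open>auto intro: card_Diff1_less simp del: card_Diff_insert\<close>)
  then have "0 \<le> (\<Sum>y\<in>?Y. poly (?W (S - {u}) y) x)" by (intro sum_nonneg) auto
  also have "\<dots> = poly (\<Sum>y\<in>?Y. ?W (S - {u}) y) x" by (simp add: poly_sum)
  also have "(\<Sum>y\<in>?Y. ?W (S - {u}) y) =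
     (\<Sum>y\<in>?Y. F (S - {u, y})) * pderiv (F (S - {u})) - F (S - {u}) * pderiv (\<Sum>y\<in>?Y. F (S - {u, y}))"
    unfolding s by (simp add: sum_subtractf sum_distrib_left sum_distrib_right higher_pderiv_sum[of 1, simplified])
  also have "(\<Sum>y\<in>?Y. F (S - {u, y})) = [:\<theta>, 1:] * F (S - {u}) - F S"
    using F_rec[OF less.prems] by simp
  finally show ?case
    by (simp add: pderiv_diff pderiv_mult pderiv_pCons algebra_simps power2_eq_square del: mult_pCons_left)
qed

lemma mu_le_delete:
  assumes "finite S" "u \<in> S" shows "mu S \<le> mu (S - {u}) + 1"
proof (rule ccontr)
  let ?q = "F (S - {u})" and ?j = "mu (S - {u})"
  let ?g = "?q * pderiv (F S) - F S * pderiv ?q"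
  assume "\<not> ?thesis"
  then have k: "?j + 2 \<le> mu S" by simp
  have q: "monom 1 ?j dvd ?q" using assms by (simp add: monom_dvd_F_iff)
  have p: "monom 1 (?j + 2) dvd F S" using assms k by (simp add: monom_dvd_F_iff)
  have "monom 1 (2 * ?j + 1) dvd ?g"
    using monom_dvd_mult[OF q monom_dvd_pderiv[OF p], of "2 * ?j + 1"]
      monom_dvd_mult[OF p monom_dvd_pderiv[OF q], of "2 * ?j + 1"] by (intro dvd_diff) auto
  then have g: "coeff ?g i = 0" if "i \<le> 2 * ?j" for i
    using that by (simp add: monom_1_dvd_iff' del: coeff_diff)
  have "monom 1 (2 * ?j) dvd ?g" by (simp add: monom_1_dvd_iff' g del: coeff_diff)
  moreover have "monom 1 (2 * ?j) dvd ?q * ?q" using monom_dvd_mult[OF q q] by simp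
  ultimately have "monom 1 (2 * ?j) dvd ?g - ?q * ?q" by (rule dvd_diff)
  moreover have "0 \<le> poly (?g - ?q * ?q) x" for x
    using wronskian_ge[OF assms, of x] by (simp add: power2_eq_square)
  ultimately have "0 \<le> coeff (?g - ?q * ?q) (2 * ?j)" by (rule nonneg_lowest_coeff[rotated])
  also have "\<dots> = - (coeff ?q ?j)\<^sup>2"
    using coeff_mult_monom_dvd[OF q q] g[of "2 * ?j"] by (simp add: mult_2 power2_eq_square)
  finally show False using coeff_F_mu[of "S - {u}"] assms by simp
qed

lemma mu_delete_le:
  assumes "finite S" "u \<in> S" shows "mu (S - {u}) \<le> mu S + 1"
proof -
  let ?j = "mu (S - {u}) - 1"
  have "monom 1 ?j dvd F (S - {u, y})" if "y \<in> S" "E u y" for y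
  proof -
    have "y \<in> S - {u}" "S - {u} - {y} = S - {u, y}" using that irr by auto
    then show ?thesis using mu_le_delete[of "S - {u}" y] assms by (simp add: monom_dvd_F_iff)
  qed
  moreover have "monom 1 ?j dvd [:\<theta>, 1:] * F (S - {u})"
    using assms by (intro dvd_mult) (simp add: monom_dvd_F_iff)
  ultimately have "monom 1 ?j dvd F S"
    unfolding F_rec[OF assms] by (intro dvd_diff dvd_sum) auto
  then show ?thesis using assms by (simp add: monom_dvd_F_iff)
qed

lemma mu_Diff_bounds:
  assumes "finite S" "A \<subseteq> S"
  shows "mu S \<le> mu (S - A) + card A" "mu (S - A) \<le> mu S + card A"
proof -
  have "finite A" using assms finite_subset by blast
  then have "mu S \<le> mu (S - A) + card A \<and> mu (S - A) \<le> mu S + card A" using assms(2)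
  proof induction
    case (insert a A)
    have s: "S - A - {a} = S - insert a A" by auto
    have "finite (S - A)" "a \<in> S - A" using insert assms by auto
    then show ?case using mu_le_delete[of "S - A" a] mu_delete_le[of "S - A" a] insert
      unfolding s by auto
  qed simp
  then show "mu S \<le> mu (S - A) + card A" "mu (S - A) \<le> mu S + card A" by auto
qed

text \<open>The Wronskian is nonnegative, hence so is its lowest coefficient.\<close>
lemma coeff_delete_sign:
  assumes "finite S" "u \<in> S" "Suc n \<le> mu S"
  shows "0 \<le> coeff (F S) (Suc n) * coeff (F (S - {u})) n"
proof -
  let ?p = "F S" and ?q = "F (S - {u})"
  let ?g = "?q * pderiv ?p - ?p * pderiv ?q"
  have p: "monom 1 (Suc n) dvd ?p" using assms by (simp add: monom_dvd_F_iff)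
  have q: "monom 1 n dvd ?q" using assms mu_le_delete[of S u] by (simp add: monom_dvd_F_iff)
  note p' = monom_dvd_pderiv[OF p] and q' = monom_dvd_pderiv[OF q]
  have "monom 1 (2 * n) dvd ?g"
    using monom_dvd_mult[OF q p', of "2 * n"] monom_dvd_mult[OF p q', of "2 * n"]
    by (intro dvd_diff) auto
  moreover have "0 \<le> poly ?g x" for x
    by (rule order_trans[OF zero_le_power2 wronskian_ge[OF assms(1,2)]])
  ultimately have "0 \<le> coeff ?g (2 * n)" by (rule nonneg_lowest_coeff[rotated])
  also have "\<dots> = coeff (?q * pderiv ?p) (2 * n) - coeff (?p * pderiv ?q) (2 * n)" by simp
  also have "coeff (?q * pderiv ?p) (2 * n) = real (Suc n) * (coeff ?p (Suc n) * coeff ?q n)"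
    using coeff_mult_monom_dvd[OF q p'] by (simp add: mult_2 coeff_pderiv)
  also have "coeff (?p * pderiv ?q) (2 * n) = real n * (coeff ?p (Suc n) * coeff ?q n)"
  proof (cases n)
    case 0
    have "coeff ?p 0 = 0" using p by (simp add: monom_1_dvd_iff')
    then show ?thesis using 0 by (simp add: coeff_mult_0)
  next
    case (Suc m)
    then show ?thesis using coeff_mult_monom_dvd[OF p q'] by (simp add: mult_2 coeff_pderiv)
  qed
  finally show ?thesis by (simp add: coeff_diff algebra_simps)
qed

lemma poly_rayleigh_nonneg:
  assumes "finite S" "u \<in> S" "v \<in> S" "u \<noteq> v"
  shows "0 \<le> poly (F (S - {u}) * F (S - {v}) - F S * F (S - {u, v})) x"
  using rayleigh_difference_nonneg[of "\<lambda>S. poly (F S) x" "\<lambda>_. \<theta> + x" E, OF poly_F_rec irr assms]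
  by simp

lemma mu_path4_delete_gt:
  assumes "finite S" "distinct [u, y, z, v]" "{u, y, z, v} \<subseteq> S" "E u y" "E y z" "E z v"
    and "mu S = k" "mu (S - {u, v}) = k + 2"
  shows "k < mu (S - {u, y, z, v})"
proof (rule ccontr)
  let ?q = "F (S - {u, y, z, v})" and ?j = "mu (S - {u, y, z, v})"
  let ?g = "F (S - {u}) * F (S - {v}) - F S * F (S - {u, v})"
  assume "\<not> ?thesis"
  then have j: "?j \<le> k" by simp
  have s: "S - {u} - {v} = S - {u, v}" "S - {v} - {u} = S - {u, v}" by auto
  have "k + 1 \<le> mu (S - {u})" "k + 1 \<le> mu (S - {v})"
    using mu_delete_le[of "S - {u}" v] mu_delete_le[of "S - {v}" u] assms unfolding s by auto
  then have d: "monom 1 (k + 1) dvd F (S - {u})" "monom 1 (k + 1) dvd F (S - {v})"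
    "monom 1 k dvd F S" "monom 1 (k + 2) dvd F (S - {u, v})"
    using assms by (simp_all add: monom_dvd_F_iff)
  have "monom 1 (2 * ?j + 1) dvd ?g"
    using j by (intro dvd_diff monom_dvd_mult[OF d(1,2)] monom_dvd_mult[OF d(3,4)]) auto
  then have g: "coeff ?g i = 0" if "i \<le> 2 * ?j" for i
    using that by (simp add: monom_1_dvd_iff' del: coeff_diff)
  have q: "monom 1 ?j dvd ?q" using assms by (simp add: monom_dvd_F_iff)
  have "monom 1 (2 * ?j) dvd ?g" by (simp add: monom_1_dvd_iff' g del: coeff_diff)
  moreover have "monom 1 (2 * ?j) dvd ?q * ?q" using monom_dvd_mult[OF q q] by simp
  ultimately have "monom 1 (2 * ?j) dvd ?g - ?q * ?q" by (rule dvd_diff)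
  moreover have "0 \<le> poly (?g - ?q * ?q) x" for x
    using rayleigh_difference_ge_path4[of "\<lambda>S. poly (F S) x" "\<lambda>_. \<theta> + x" E, OF poly_F_rec irr assms(1-6)]
    by (simp add: power2_eq_square)
  ultimately have "0 \<le> coeff (?g - ?q * ?q) (2 * ?j)" by (rule nonneg_lowest_coeff[rotated])
  also have "\<dots> = - (coeff ?q ?j)\<^sup>2"
    using coeff_mult_monom_dvd[OF q q] g[of "2 * ?j"] by (simp add: mult_2 power2_eq_square)
  finally show False using coeff_F_mu[of "S - {u, y, z, v}"] assms by simp
qed

text \<open>Raising the weight of the vertex \<open>w\<close> by \<open>c\<close> turns the Rayleigh difference of u, v into a
quadratic polynomial in c; being nonnegative, it has nonpositive discriminant.\<close>
lemma rayleigh_discriminant: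
  assumes "finite S" "distinct [u, v, w]" "{u, v, w} \<subseteq> S"
  defines "a \<equiv> F (S - {u}) * F (S - {v}) - F S * F (S - {u, v})"
    and "b \<equiv> F (S - {u}) * F (S - {v, w}) + F (S - {u, w}) * F (S - {v})
              - F S * F (S - {u, v, w}) - F (S - {w}) * F (S - {u, v})"
    and "c \<equiv> F (S - {u, w}) * F (S - {v, w}) - F (S - {w}) * F (S - {u, v, w})"
  shows "(poly b x)\<^sup>2 \<le> 4 * poly a x * poly c x"
proof (rule discriminant_nonpos)
  have "S - {w} - {u} = S - {u, w}" "S - {w} - {v} = S - {v, w}" "S - {w} - {u, v} = S - {u, v, w}"
    by auto
  then show "0 \<le> poly c x"
    using poly_rayleigh_nonneg[of "S - {w}" u v x] assms(1-3) by (simp add: c_def)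
  fix t
  define G where "G S = poly (F S) x + (if w \<in> S then t * poly (F (S - {w})) x else 0)" for S
  have "G S = (\<theta> + x + (if u = w then t else 0)) * G (S - {u}) - (\<Sum>y | y \<in> S \<and> E u y. G (S - {u, y}))"
    if S: "finite S" "u \<in> S" for S u
  proof (cases "u = w")
    case True
    then show ?thesis using poly_F_rec[OF S, of x] S by (simp add: G_def algebra_simps)
  next
    case False
    show ?thesis
    proof (cases "w \<in> S")
      case w: True
      have s: "S - {u} - {w} = S - {w} - {u}" "\<And>y. S - {u, y} - {w} = S - {w} - {u, y}" by auto
      have "(\<Sum>y | y \<in> S \<and> E u y. G (S - {u, y})) = (\<Sum>y | y \<in> S \<and> E u y. poly (F (S - {u, y})) x)
         + t * (\<Sum>y | y \<in> S \<and> E u y. if y = w then 0 else poly (F (S - {w} - {u, y})) x)"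
        using w False by (simp add: G_def s sum.distrib[symmetric] sum_distrib_left, intro sum.cong) (auto simp: s)
      also have "(\<Sum>y | y \<in> S \<and> E u y. if y = w then 0 else poly (F (S - {w} - {u, y})) x) =
         (\<Sum>y | y \<in> S - {w} \<and> E u y. poly (F (S - {w} - {u, y})) x)"
        using S by (intro sum.mono_neutral_cong_right) auto
      finally have sum: "(\<Sum>y | y \<in> S \<and> E u y. G (S - {u, y})) = (\<Sum>y | y \<in> S \<and> E u y. poly (F (S - {u, y})) x)
         + t * (\<Sum>y | y \<in> S - {w} \<and> E u y. poly (F (S - {w} - {u, y})) x)" .
      have "G S = poly (F S) x + t * poly (F (S - {w})) x"
        "G (S - {u}) = poly (F (S - {u})) x + t * poly (F (S - {w} - {u})) x"
        using w False by (simp_all add: G_def s)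
      moreover have "u \<in> S - {w}" using S False by simp
      then have "poly (F (S - {w})) x = (\<theta> + x) * poly (F (S - {w} - {u})) x
          - (\<Sum>y | y \<in> S - {w} \<and> E u y. poly (F (S - {w} - {u, y})) x)"
        using S(1) by (intro poly_F_rec) auto
      ultimately show ?thesis
        using poly_F_rec[OF S, of x] False by (simp only: sum) (simp add: algebra_simps)
    next
      case w: False
      then show ?thesis using poly_F_rec[OF S, of x] False by (simp add: G_def)
    qed
  qed
  note rayleigh_difference_nonneg[of G _ E, OF this irr assms(1), of u v]
  then have "0 \<le> G (S - {u}) * G (S - {v}) - G S * G (S - {u, v})" using assms(2,3) by simp
  moreover have "S - {u} - {w} = S - {u, w}" "S - {v} - {w} = S - {v, w}" "S - {u, v} - {w} = S - {u, v, w}"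
    by auto
  then have "G (S - {u}) = poly (F (S - {u})) x + t * poly (F (S - {u, w})) x"
    "G (S - {v}) = poly (F (S - {v})) x + t * poly (F (S - {v, w})) x"
    "G (S - {u, v}) = poly (F (S - {u, v})) x + t * poly (F (S - {u, v, w})) x"
    "G S = poly (F S) x + t * poly (F (S - {w})) x"
    using assms(2,3) by (auto simp: G_def)
  ultimately show "0 \<le> poly a x + poly b x * t + poly c x * t\<^sup>2"
    by (simp add: a_def b_def c_def algebra_simps power2_eq_square)
qed

lemma mu_delete_triple:
  assumes "finite S" "distinct [u, v, w]" "{u, v, w} \<subseteq> S"
    and k: "mu S = k" "mu (S - {u, v}) = k + 2" "mu (S - {u, w}) = k + 2" "mu (S - {v, w}) = k + 2"
  shows "mu (S - {u, v, w}) = k + 3"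
proof (rule ccontr)
  assume neq: "mu (S - {u, v, w}) \<noteq> k + 3"
  define j where "j = mu (S - {u, v, w})"
  have s: "S - {u, v} - {w} = S - {u, v, w}" "S - {u} - {v} = S - {u, v}"
    "S - {u} - {w} = S - {u, w}" "S - {w} - {u} = S - {u, w}"
    "S - {v} - {u} = S - {u, v}" by auto
  have "w \<in> S - {u, v}" "finite (S - {u, v})" using assms by auto
  then have j: "j \<le> k + 2" "k + 1 \<le> j"
    using mu_delete_le[of "S - {u, v}" w] mu_le_delete[of "S - {u, v}" w] k neq
    unfolding j_def s by simp_all
  have "k + 1 \<le> mu (S - {u})" "k + 1 \<le> mu (S - {v})" "k + 1 \<le> mu (S - {w})"
    using mu_delete_le[of "S - {u}" v] mu_delete_le[of "S - {v}" u] mu_delete_le[of "S - {w}" u] assms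
    unfolding s by auto
  then have d1: "monom 1 (k + 1) dvd F (S - {u})" "monom 1 (k + 1) dvd F (S - {v})"
    "monom 1 (k + 1) dvd F (S - {w})" and d0: "monom 1 k dvd F S" and
    d2: "monom 1 (k + 2) dvd F (S - {u, v})" "monom 1 (k + 2) dvd F (S - {u, w})"
    "monom 1 (k + 2) dvd F (S - {v, w})" and d3: "monom 1 j dvd F (S - {u, v, w})"
    using assms by (simp_all add: monom_dvd_F_iff j_def)
  let ?a = "F (S - {u}) * F (S - {v}) - F S * F (S - {u, v})"
  let ?b' = "F (S - {u}) * F (S - {v, w}) + F (S - {u, w}) * F (S - {v}) - F (S - {w}) * F (S - {u, v})"
  let ?b = "F (S - {u}) * F (S - {v, w}) + F (S - {u, w}) * F (S - {v})
              - F S * F (S - {u, v, w}) - F (S - {w}) * F (S - {u, v})"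
  let ?c = "F (S - {u, w}) * F (S - {v, w}) - F (S - {w}) * F (S - {u, v, w})"
  have a: "monom 1 (2 * k + 2) dvd ?a"
    by (intro dvd_diff monom_dvd_mult[OF d1(1,2)] monom_dvd_mult[OF d0 d2(1)]) auto
  have c: "monom 1 (k + 1 + j) dvd ?c"
    using j by (intro dvd_diff monom_dvd_mult[OF d2(2,3)] monom_dvd_mult[OF d1(3) d3]) auto
  have b': "monom 1 (k + j + 1) dvd ?b'"
    using j by (intro dvd_diff dvd_add monom_dvd_mult[OF d1(1) d2(3)] monom_dvd_mult[OF d2(2) d1(2)]
        monom_dvd_mult[OF d1(3) d2(1)]) auto
  have b_eq: "?b = ?b' - F S * F (S - {u, v, w})" by simp
  have b: "monom 1 (k + j) dvd ?b"
    unfolding b_eq by (intro dvd_diff monom_dvd_mult[OF d0 d3] dvd_trans[OF _ b']) (auto simp: monom_1_dvd_iff' coeff_monom)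
  have "coeff ?b' (k + j) = 0" using b' by (simp add: monom_1_dvd_iff' del: coeff_diff coeff_add)
  then have bc: "coeff ?b (k + j) = - (coeff (F S) k * coeff (F (S - {u, v, w})) j)"
    unfolding b_eq coeff_diff[of ?b'] using coeff_mult_monom_dvd[OF d0 d3] by simp
  let ?g = "smult 4 (?a * ?c) - ?b * ?b"
  have ac: "monom 1 (2 * (k + j) + 1) dvd ?a * ?c"
    using j by (intro monom_dvd_mult[OF a c]) auto
  then have "coeff (?a * ?c) i = 0" if "i \<le> 2 * (k + j)" for i
    using that by (simp add: monom_1_dvd_iff' del: coeff_diff)
  then have "monom 1 (2 * (k + j)) dvd smult 4 (?a * ?c)" and ac0: "coeff (?a * ?c) (2 * (k + j)) = 0"
    by (auto simp add: monom_1_dvd_iff' simp del: coeff_diff)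
  then have "monom 1 (2 * (k + j)) dvd ?g"
    by (intro dvd_diff monom_dvd_mult[OF b b]) auto
  moreover have "0 \<le> poly ?g x" for x
    using rayleigh_discriminant[OF assms(1-3), of x]
    unfolding poly_diff[of "smult 4 _"] poly_smult poly_mult[of ?a ?c] poly_mult[of ?b ?b]
    by (simp only: power2_eq_square mult.assoc diff_ge_0_iff_ge)
  ultimately have "0 \<le> coeff ?g (2 * (k + j))" by (rule nonneg_lowest_coeff[rotated])
  also have "\<dots> = - (coeff ?b (k + j))\<^sup>2"
    using coeff_mult_monom_dvd[OF b b] unfolding coeff_diff[of "smult 4 _"] coeff_smult ac0
    by (simp only: mult_2[symmetric] power2_eq_square)
  finally have "coeff ?b (k + j) = 0" by simp
  then show False
    unfolding bc using coeff_F_mu[of S] coeff_F_mu[of "S - {u, v, w}"] assms by (simp add: j_def)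
qed

lemma mu_delete_pairwise_nice:
  assumes "finite S" "X \<subseteq> S" "2 \<le> card X" "A \<subseteq> X"
    and pairs: "\<And>u v. u \<in> X \<Longrightarrow> v \<in> X \<Longrightarrow> u \<noteq> v \<Longrightarrow> mu (S - {u, v}) = mu S + 2"
  shows "mu (S - A) = mu S + card A"
  using assms(4)
proof (induction "card A" arbitrary: A rule: less_induct)
  case less
  have finX: "finite X" using assms finite_subset by blast
  then have fin: "finite A" using less.prems finite_subset by blast
  consider "card A = 0" | "card A = 1" | "card A = 2" | n where "card A = Suc (Suc (Suc n))"
    by (metis One_nat_def Suc_1 not0_implies_Suc)
  then show ?case
  proof cases
    case 1 then show ?thesis using fin by simp
  next
    case 2
    then obtain u where u: "A = {u}" by (rule card_1_singletonE)
    have "X \<noteq> {u}" using assms(3) by auto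
    then obtain v where v: "v \<in> X" "v \<noteq> u" using u less.prems by auto
    have "S - {u} - {v} = S - {u, v}" by auto
    moreover have "u \<in> S" "v \<in> S - {u}" using u v less.prems assms(2) by auto
    moreover have "mu (S - {u, v}) = mu S + 2" using u v less.prems by (intro pairs) auto
    ultimately show ?thesis using mu_delete_le[of "S - {u}" v] mu_delete_le[of S u] u assms(1) by simp
  next
    case 3
    then obtain u v where "A = {u, v}" "u \<noteq> v" by (auto simp: card_2_iff)
    then show ?thesis using pairs less.prems by simp
  next
    case 4
    then obtain u A' where u: "A = insert u A'" "u \<notin> A'" "card A' = Suc (Suc n)"
      using card_Suc_eq[of A "Suc (Suc n)"] by blast
    then obtain v A'' where v: "A' = insert v A''" "v \<notin> A''" "card A'' = Suc n"
      using card_Suc_eq[of A' "Suc n"] by blast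
    then obtain w B where w: "A'' = insert w B" "w \<notin> B" "card B = n"
      using card_Suc_eq[of A'' n] by blast
    have A: "A = insert u (insert v (insert w B))" and d: "distinct [u, v, w]" "u \<notin> B" "v \<notin> B" "w \<notin> B"
      using u v w by auto
    have finB: "finite B" using fin A by simp
    have IH: "mu (S - C) = mu S + card C" if "C \<subseteq> A" "card C < card A" for C
      using less.hyps[of C] that less.prems by auto
    have s: "S - B - {u, v} = S - insert u (insert v B)" "S - B - {u, w} = S - insert u (insert w B)"
      "S - B - {v, w} = S - insert v (insert w B)" "S - B - {u, v, w} = S - A"
      using A by auto
    have "mu (S - B - {u, v, w}) = mu S + card B + 3"
    proof (rule mu_delete_triple)
      show "mu (S - B) = mu S + card B" using 4 w A by (intro IH) auto
      show "mu (S - B - {u, v}) = mu S + card B + 2"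
        unfolding s using 4 w A d finB by (subst IH) auto
      show "mu (S - B - {u, w}) = mu S + card B + 2"
        unfolding s using 4 w A d finB by (subst IH) auto
      show "mu (S - B - {v, w}) = mu S + card B + 2"
        unfolding s using 4 w A d finB by (subst IH) auto
    qed (use A d less.prems assms in auto)
    then show ?thesis unfolding s using 4 w by simp
  qed
qed
end

section \<open>Exchanging nice vertices for neighbours\<close>

context irreflexive_symmetric
begin

lemma coeff_Diff_sign:
  assumes "finite S" "T \<subseteq> S" "r \<le> mu S" "card T \<le> r"
  shows "0 \<le> coeff (F S) r * coeff (F (S - T)) (r - card T)"
proof -
  have "finite T" using assms finite_subset by blast
  then show ?thesis using assms(2,4)
  proof induction
    case (insert u T)
    define n where "n = r - card T - 1"
    have n: "r - card T = Suc n" "r - card (insert u T) = n" using insert by (auto simp: n_def)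
    have s: "S - insert u T = S - T - {u}" by auto
    have ST: "finite (S - T)" "u \<in> S - T" using insert assms by auto
    have mu: "Suc n \<le> mu (S - T)" using mu_Diff_bounds(1)[of S T] insert.prems assms(1,3) n by auto
    let ?a = "coeff (F (S - T)) (Suc n)" and ?b = "coeff (F (S - insert u T)) n"
    have IH: "0 \<le> coeff (F S) r * ?a" using insert n by simp
    have ab: "0 \<le> ?a * ?b" unfolding s by (rule coeff_delete_sign[OF ST mu])
    show ?case unfolding n
    proof (cases "?a = 0")
      case True
      then have "mu (S - T) \<noteq> Suc n" using coeff_F_mu[OF ST(1)] by auto
      then have "n < mu (S - insert u T)" using mu mu_le_delete[OF ST] unfolding s by simp
      then have "?b = 0" using assms(1) by (intro coeff_F_eq_0) auto
      then show "0 \<le> coeff (F S) r * ?b" by simp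
    next
      case False
      then show "0 \<le> coeff (F S) r * ?b" using IH ab by (auto simp: zero_le_mult_iff)
    qed
  qed (simp add: assms)
qed

context
  fixes V X :: "'a set" and k :: nat
  assumes finV: "finite V" and XV: "X \<subseteq> V"
    and mu_del: "\<And>A. A \<subseteq> X \<Longrightarrow> mu (V - A) = k + card A"
begin

lemma finX: "finite X" using finV XV finite_subset by blast

lemma exchange_rec:
  assumes "S \<subseteq> X" "T \<subseteq> V - X" "card T = card S" "x \<in> X - S"
  shows "coeff (F (V - S - T)) k =
    - (\<Sum>z | z \<in> V - X - T \<and> E x z. coeff (F (V - insert x S - insert z T)) k)"
proof -
  let ?W = "V - S - T"
  have finS: "finite S" and finT: "finite T"
    using assms finX finV by (meson finite_subset finite_Diff)+
  have low: "coeff (F (V - A - T)) j = 0" if "A \<subseteq> X" "j + card S < k + card A" for A j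
  proof (rule coeff_F_eq_0)
    have "mu (V - A) \<le> mu (V - A - T) + card T"
      using finV assms(2) that by (intro mu_Diff_bounds) auto
    then show "j < mu (V - A - T)" using mu_del[OF that(1)] that(2) assms(3) by simp
  qed (use finV in simp)
  have x: "x \<in> ?W" using assms XV by auto
  have "?W - {x} = V - insert x S - T" by auto
  moreover have "coeff (F (V - insert x S - T)) k = 0"
    "k \<noteq> 0 \<Longrightarrow> coeff (F (V - insert x S - T)) (k - 1) = 0"
    using assms finS by (auto intro!: low)
  ultimately have "coeff (F ?W) k = - (\<Sum>y | y \<in> ?W \<and> E x y. coeff (F (?W - {x, y})) k)"
    using coeff_F_rec[of ?W x k] finV x by simp
  also have "(\<Sum>y | y \<in> ?W \<and> E x y. coeff (F (?W - {x, y})) k) =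
     (\<Sum>z | z \<in> V - X - T \<and> E x z. coeff (F (V - insert x S - insert z T)) k)"
  proof (rule sum.mono_neutral_cong_right)
    show "\<forall>y\<in>{y \<in> ?W. E x y} - {z \<in> V - X - T. E x z}. coeff (F (?W - {x, y})) k = 0"
    proof
      fix y assume "y \<in> {y \<in> ?W. E x y} - {z \<in> V - X - T. E x z}"
      then have y: "y \<in> X" "y \<notin> S" "x \<noteq> y" using assms irr by auto
      have "?W - {x, y} = V - insert x (insert y S) - T" by auto
      moreover have "coeff (F (V - insert x (insert y S) - T)) k = 0"
        using y assms finS by (intro low) auto
      ultimately show "coeff (F (?W - {x, y})) k = 0" by simp
    qed
    fix z assume "z \<in> {z \<in> V - X - T. E x z}"
    have "?W - {x, z} = V - insert x S - insert z T" by auto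
    then show "coeff (F (?W - {x, z})) k = coeff (F (V - insert x S - insert z T)) k" by simp
  qed (use finV assms in auto)
  finally show ?thesis .
qed

abbreviation "lead \<equiv> coeff (F (V - X)) (k + card X)"

lemma exchange_sign:
  assumes "S \<subseteq> X" "T \<subseteq> V - X" "card T = card S"
  shows "0 \<le> lead * (- 1) ^ card (X - S) * coeff (F (V - S - T)) k"
  using assms
proof (induction "card (X - S)" arbitrary: S T)
  case 0
  then have "S = X" using finX by auto
  moreover have "0 \<le> lead * coeff (F (V - X - T)) (k + card X - card T)"
    using 0 finV mu_del[of X] \<open>S = X\<close> by (intro coeff_Diff_sign) auto
  ultimately show ?case using 0 by simp
next
  case (Suc n)
  then obtain x where x: "x \<in> X - S" by (metis card.empty equals0I nat.distinct(1))
  have finS: "finite S" and finT: "finite T"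
    using Suc.prems finX finV by (meson finite_subset finite_Diff)+
  have X: "X - insert x S = X - S - {x}" by auto
  have n: "card (X - insert x S) = n" unfolding X using Suc(2) x by simp
  have "0 \<le> lead * (- 1) ^ card (X - insert x S) * coeff (F (V - insert x S - insert z T)) k"
    if "z \<in> V - X - T" for z
    using that Suc.prems x finS finT n by (intro Suc(1)) auto
  then have "0 \<le> (\<Sum>z | z \<in> V - X - T \<and> E x z. lead * (- 1) ^ n * coeff (F (V - insert x S - insert z T)) k)"
    unfolding n by (intro sum_nonneg) auto
  then show ?case
    unfolding exchange_rec[OF Suc.prems x] Suc(2)[symmetric] by (simp add: sum_distrib_left sum_negf)
qed

text \<open>All terms of the recurrence have the same sign, so nothing cancels.\<close>
lemma exchange_nonzero_iff:
  assumes "S \<subseteq> X" "T \<subseteq> V - X" "card T = card S" "x \<in> X - S"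
  shows "coeff (F (V - S - T)) k \<noteq> 0 \<longleftrightarrow>
    (\<exists>z \<in> V - X - T. E x z \<and> coeff (F (V - insert x S - insert z T)) k \<noteq> 0)"
proof -
  let ?Z = "{z \<in> V - X - T. E x z}"
  let ?s = "lead * (- 1) ^ card (X - insert x S)"
  have finS: "finite S" and finT: "finite T"
    using assms finX finV by (meson finite_subset finite_Diff)+
  have "lead \<noteq> 0" using coeff_F_mu[of "V - X"] mu_del[of X] finV by simp
  then have s: "?s \<noteq> 0" by simp
  have nonneg: "0 \<le> ?s * coeff (F (V - insert x S - insert z T)) k" if "z \<in> ?Z" for z
    using that assms finS finT by (intro exchange_sign) auto
  have "coeff (F (V - S - T)) k = 0 \<longleftrightarrow> ?s * (\<Sum>z\<in>?Z. coeff (F (V - insert x S - insert z T)) k) = 0"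
    using s exchange_rec[OF assms] by simp
  also have "\<dots> \<longleftrightarrow> (\<forall>z\<in>?Z. ?s * coeff (F (V - insert x S - insert z T)) k = 0)"
    unfolding sum_distrib_left using finV nonneg by (intro sum_nonneg_eq_0_iff) auto
  finally show ?thesis using s by auto
qed

lemma exists_exchange_system:
  "\<exists>f. inj_on f X \<and> (\<forall>x\<in>X. f x \<in> V - X \<and> E x (f x)) \<and> coeff (F (V - X - f ` X)) k \<noteq> 0"
proof -
  have "\<exists>f. inj_on f S \<and> (\<forall>x\<in>S. f x \<in> V - X \<and> E x (f x)) \<and> coeff (F (V - S - f ` S)) k \<noteq> 0"
    if "finite S" "S \<subseteq> X" for S
    using that
  proof (induction rule: finite_induct)
    case empty
    then show ?case using coeff_F_mu[of V] mu_del[of "{}"] finV by simp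
  next
    case (insert x S)
    then obtain f where f: "inj_on f S" "\<forall>x\<in>S. f x \<in> V - X \<and> E x (f x)"
      "coeff (F (V - S - f ` S)) k \<noteq> 0" by auto
    then obtain z where z: "z \<in> V - X - f ` S" "E x z"
      "coeff (F (V - insert x S - insert z (f ` S))) k \<noteq> 0"
      using exchange_nonzero_iff[of S "f ` S" x] insert by (auto simp: card_image)
    have "f(x := z) ` S = f ` S" using insert(2) by auto
    then show ?case
      using f z insert(2) by (intro exI[of _ "f(x := z)"]) (auto simp: inj_on_def)
  qed
  then show ?thesis using finX by blast
qed

lemma mu_exchange:
  assumes f: "inj_on f X" "\<forall>x\<in>X. f x \<in> V - X \<and> E x (f x)" "coeff (F (V - X - f ` X)) k \<noteq> 0"
    and I: "I \<subseteq> X"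
  shows "mu (V - I - f ` I) = k"
proof -
  have "coeff (F (V - (X - J) - f ` (X - J))) k \<noteq> 0" if "finite J" "J \<subseteq> X" for J
    using that
  proof (induction rule: finite_induct)
    case empty then show ?case using f by simp
  next
    case (insert x J)
    let ?S = "X - insert x J"
    have s: "X - J = insert x ?S" using insert by auto
    have "f x \<notin> f ` ?S" using f(1) insert.prems by (auto simp: inj_on_def)
    then have "\<exists>z \<in> V - X - f ` ?S. E x z \<and> coeff (F (V - insert x ?S - insert z (f ` ?S))) k \<noteq> 0"
      using insert f unfolding s by (intro bexI[of _ "f x"]) auto
    moreover have "card (f ` ?S) = card ?S"
      by (rule card_image, rule inj_on_subset[OF f(1)]) blast
    ultimately show ?case
      using insert.prems f(2) by (subst exchange_nonzero_iff) auto
  qed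
  from this[of "X - I"] have "coeff (F (V - I - f ` I)) k \<noteq> 0"
    using I finX by (simp add: double_diff)
  then have "mu (V - I - f ` I) \<le> k" using coeff_F_eq_0[of "V - I - f ` I" k] finV not_le by blast
  moreover have "card (f ` I) = card I" by (rule card_image[OF inj_on_subset[OF f(1) I]])
  then have "k \<le> mu (V - I - f ` I)"
    using mu_Diff_bounds(1)[of "V - I" "f ` I"] mu_del[OF I] finV f(2) I by fastforce
  ultimately show ?thesis by simp
qed

end
end

theorem theorem6p4:
  fixes V :: "'a set" and E :: "'a \<Rightarrow> 'a \<Rightarrow> bool" and \<theta> :: real and X :: "'a set"
  assumes "simple_graph V E"
    and "nice \<theta> V E X"
  shows "\<exists>Y f. Y \<subseteq> V \<and> Y \<inter> X = {} \<and> bij_betw f X Y \<and>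
     (let M = (\<lambda>x. {x, f x}) ` X in
        is_matching V E M \<and> card M = card X \<and>
        (\<forall>M' \<subseteq> M. mult \<theta> (V - \<Union>M') E = mult \<theta> V E \<and>
           (card (X - \<Union>M') \<ge> 2 \<longrightarrow> nice \<theta> (V - \<Union>M') E (X - \<Union>M')))) \<and>
     independent V E Y"
proof -
  interpret irreflexive_symmetric E \<theta>
    using assms(1) by unfold_locales (auto simp: simple_graph_def)
  have finV: "finite V" using assms(1) by (simp add: simple_graph_def)
  have X: "X \<subseteq> V" "2 \<le> card X" and pairs: "\<And>u v. u \<in> X \<Longrightarrow> v \<in> X \<Longrightarrow> u \<noteq> v \<Longrightarrow> mu (V - {u, v}) = mu V + 2"
    using assms(2) by (auto simp: nice_def)
  have finX: "finite X" using X finV finite_subset by blast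
  have del: "mu (V - A) = mu V + card A" if "A \<subseteq> X" for A
    using mu_delete_pairwise_nice[OF finV X that pairs] .
  obtain f where f: "inj_on f X" "\<forall>x\<in>X. f x \<in> V - X \<and> E x (f x)"
    and nz: "coeff (F (V - X - f ` X)) (mu V) \<noteq> 0"
    using exists_exchange_system[OF finV X(1) del] by blast
  have mu_I: "mu (V - I - f ` I) = mu V" if "I \<subseteq> X" for I
    using mu_exchange[OF finV X(1) del f nz that] .
  let ?e = "\<lambda>x. {x, f x}"
  have disj: "?e x \<inter> ?e y = {}" if "x \<in> X" "y \<in> X" "x \<noteq> y" for x y
    using that f by (auto simp: inj_on_def)
  have inj: "inj_on ?e X" using disj by (auto simp: inj_on_def)
  have matching: "is_matching V E (?e ` X)"
    using f X(1) disj unfolding is_matching_def edges_def by blast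
  have M': "mult \<theta> (V - \<Union>M') E = mult \<theta> V E \<and>
     (card (X - \<Union>M') \<ge> 2 \<longrightarrow> nice \<theta> (V - \<Union>M') E (X - \<Union>M'))" if sub: "M' \<subseteq> ?e ` X" for M'
  proof -
    obtain I where I: "I \<subseteq> X" "M' = ?e ` I" by (rule subset_imageE[OF sub])
    have VM: "V - \<Union>M' = V - I - f ` I" and XM: "X - \<Union>M' = X - I"
      using I f by auto
    have finI: "finite I" using I finX finite_subset by blast
    have cI: "card (f ` I) = card I" by (rule card_image[OF inj_on_subset[OF f(1) I(1)]])
    have "mu (V - I - f ` I - {u, v}) = mu (V - I - f ` I) + 2"
      if uv: "u \<in> X - I" "v \<in> X - I" "u \<noteq> v" for u v
    proof -
      let ?W = "V - I - f ` I"
      have uvW: "{u, v} \<subseteq> ?W" using uv X(1) f I by auto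
      have s: "?W - {u, v} = V - insert u (insert v I) - f ` I" by auto
      have "mu (V - insert u (insert v I)) = mu V + card I + 2"
        using uv I finI by (subst del) auto
      moreover have "mu (V - insert u (insert v I)) \<le> mu (?W - {u, v}) + card (f ` I)"
        unfolding s using finV I f(2) X(1) uv by (intro mu_Diff_bounds) auto
      moreover have "mu (?W - {u, v}) \<le> mu ?W + card {u, v}"
        using finV uvW by (intro mu_Diff_bounds) auto
      ultimately show ?thesis using mu_I[OF I(1)] cI uv(3) by simp
    qed
    then show ?thesis
      using mu_I[OF I(1)] X(1) f I unfolding VM XM nice_def by auto
  qed
  have "\<not> E (f a) (f b)" if ab: "a \<in> X" "b \<in> X" for a b
  proof
    assume E: "E (f a) (f b)"
    then have "a \<noteq> b" using irr by auto
    then have "mu V < mu (V - {a, f a, f b, b})"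
      using ab f X(1) finV E sym pairs
      by (intro mu_path4_delete_gt[of V a "f a" "f b" b]) (auto simp: inj_on_def)
    moreover have "V - {a, f a, f b, b} = V - {a, b} - f ` {a, b}" by auto
    ultimately show False using mu_I[of "{a, b}"] ab by simp
  qed
  then have "independent V E (f ` X)" using f by (auto simp: independent_def)
  then show ?thesis
    using f matching M' card_image[OF inj] unfolding Let_def
    by (intro exI[of _ "f ` X"] exI[of _ f]) (auto simp: inj_on_imp_bij_betw)
qed

end
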